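(* Up to isomorphism, there exist exactly $52$ dimonoids of order $3$. Counted up to isomorphism, they consist of: (i) $5$ abelian nontrivial dimonoids; (ii) $2$ commutative nontrivial dimonoids, forming a pair of dual dimonoids; (iii) $21$ nonabelian noncommutative nontrivial dimonoids, comprising exactly $10$ pairs of dual dimonoids and a single iso-dual dimonoid; (iv) $12$ commutative (equivalently, abelian) trivial dimonoids; (v) $12$ noncommutative (equivalently, nonabelian) trivial dimonoids, forming $6$ pairs of dual dimonoids.
   Context: A dimonoid is a set $D$ with two associative binary operations $\dashv,\vdash$ satisfying, for all $x,y,z\in D$: $(D_1)$ $(x\dashv y)\dashv z=x\dashv(y\vdash z)$; $(D_2)$ $(x\vdash y)\dashv z=x\vdash(y\dashv z)$; $(D_3)$ $(x\dashv y)\vdash z=x\vdash(y\vdash z)$. Its order is $|D|$. It is trivial if the operations $\dashv$ and $\vdash$ coincide, and nontrivial otherwise. A dimonoid is commutative if both $\dashv$ and $\vdash$ are commutative (noncommutative means not commutative). It is abelian if $x\dashv y=y\vdash x$ for all $x,y$ (nonabelian means not abelian). The dual dimonoid of $(D,\dashv,\vdash)$ is $(D,\dashv^d,\vdash^d)$ with $x\dashv^d y=y\vdash x$ and $x\vdash^d y=y\dashv x$. A dimonoid is iso-dual if it is isomorphic to its dual dimonoid. An isomorphism of dimonoids is a bijection preserving both operations. A "pair of dual dimonoids", in counts up to isomorphism, means a pair of distinct isomorphism classes consisting of the class of a dimonoid and the class of its dual. *)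

theory Defs
  imports "HOL-Algebra.Congruence" "HOL-Library.Disjoint_Sets"
begin

record 'a bimagma = "'a partial_object" +
  left_op :: "'a \<Rightarrow> 'a \<Rightarrow> 'a"  (infixl "\<stileturn>\<index>" 70)
  right_op :: "'a \<Rightarrow> 'a \<Rightarrow> 'a"  (infixl "\<turnstile>\<index>" 70)

text \<open>
  The operations are total functions on the ambient type; only their values on the carrier
  matter, and every notion below is relativised to the carrier accordingly.
\<close>

locale dimonoid =
  fixes D :: "'a bimagma" (structure)
  assumes left_closed: "\<lbrakk>x \<in> carrier D; y \<in> carrier D\<rbrakk> \<Longrightarrow> x \<stileturn> y \<in> carrier D"
    and right_closed: "\<lbrakk>x \<in> carrier D; y \<in> carrier D\<rbrakk> \<Longrightarrow> x \<turnstile> y \<in> carrier D"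
    and left_assoc:
      "\<lbrakk>x \<in> carrier D; y \<in> carrier D; z \<in> carrier D\<rbrakk> \<Longrightarrow> (x \<stileturn> y) \<stileturn> z = x \<stileturn> (y \<stileturn> z)"
    and right_assoc:
      "\<lbrakk>x \<in> carrier D; y \<in> carrier D; z \<in> carrier D\<rbrakk> \<Longrightarrow> (x \<turnstile> y) \<turnstile> z = x \<turnstile> (y \<turnstile> z)"
    and D1:
      "\<lbrakk>x \<in> carrier D; y \<in> carrier D; z \<in> carrier D\<rbrakk> \<Longrightarrow> (x \<stileturn> y) \<stileturn> z = x \<stileturn> (y \<turnstile> z)"
    and D2:
      "\<lbrakk>x \<in> carrier D; y \<in> carrier D; z \<in> carrier D\<rbrakk> \<Longrightarrow> (x \<turnstile> y) \<stileturn> z = x \<turnstile> (y \<stileturn> z)"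
    and D3:
      "\<lbrakk>x \<in> carrier D; y \<in> carrier D; z \<in> carrier D\<rbrakk> \<Longrightarrow> (x \<stileturn> y) \<turnstile> z = x \<turnstile> (y \<turnstile> z)"

definition dimonoid_of_order :: "nat \<Rightarrow> 'a bimagma \<Rightarrow> bool" where
  "dimonoid_of_order n D \<longleftrightarrow> dimonoid D \<and> finite (carrier D) \<and> card (carrier D) = n"

definition trivial :: "'a bimagma \<Rightarrow> bool" where
  "trivial D \<longleftrightarrow> (\<forall>x\<in>carrier D. \<forall>y\<in>carrier D. x \<stileturn>\<^bsub>D\<^esub> y = x \<turnstile>\<^bsub>D\<^esub> y)"

definition commutative :: "'a bimagma \<Rightarrow> bool" where
  "commutative D \<longleftrightarrow>
     (\<forall>x\<in>carrier D. \<forall>y\<in>carrier D. x \<stileturn>\<^bsub>D\<^esub> y = y \<stileturn>\<^bsub>D\<^esub> x) \<and>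
     (\<forall>x\<in>carrier D. \<forall>y\<in>carrier D. x \<turnstile>\<^bsub>D\<^esub> y = y \<turnstile>\<^bsub>D\<^esub> x)"

definition abelian :: "'a bimagma \<Rightarrow> bool" where
  "abelian D \<longleftrightarrow> (\<forall>x\<in>carrier D. \<forall>y\<in>carrier D. x \<stileturn>\<^bsub>D\<^esub> y = y \<turnstile>\<^bsub>D\<^esub> x)"

definition dual :: "'a bimagma \<Rightarrow> 'a bimagma" where
  "dual D = \<lparr>carrier = carrier D,
             left_op = (\<lambda>x y. y \<turnstile>\<^bsub>D\<^esub> x),
             right_op = (\<lambda>x y. y \<stileturn>\<^bsub>D\<^esub> x)\<rparr>"

definition dimonoid_iso :: "'a bimagma \<Rightarrow> 'b bimagma \<Rightarrow> ('a \<Rightarrow> 'b) set" where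
  "dimonoid_iso D E = {h. bij_betw h (carrier D) (carrier E) \<and>
     (\<forall>x\<in>carrier D. \<forall>y\<in>carrier D.
        h (x \<stileturn>\<^bsub>D\<^esub> y) = h x \<stileturn>\<^bsub>E\<^esub> h y \<and> h (x \<turnstile>\<^bsub>D\<^esub> y) = h x \<turnstile>\<^bsub>E\<^esub> h y)}"

definition isomorphic :: "'a bimagma \<Rightarrow> 'b bimagma \<Rightarrow> bool" where
  "isomorphic D E \<longleftrightarrow> dimonoid_iso D E \<noteq> {}"

definition iso_dual :: "'a bimagma \<Rightarrow> bool" where
  "iso_dual D \<longleftrightarrow> isomorphic D (dual D)"

definition iso_class :: "'a bimagma \<Rightarrow> 'a bimagma set" where
  "iso_class D = {E. dimonoid E \<and> isomorphic D E}"

definition iso_classes :: "nat \<Rightarrow> ('a bimagma \<Rightarrow> bool) \<Rightarrow> 'a bimagma set set" where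
  "iso_classes n P = iso_class ` {D. dimonoid_of_order n D \<and> P D}"

text \<open>
  The pairs of dual dimonoids, up to isomorphism, lying in a set \<open>K\<close> of isomorphism classes:
  unordered pairs of distinct members of \<open>K\<close>.
\<close>

definition dual_pairs :: "'a bimagma set set \<Rightarrow> 'a bimagma set set set" where
  "dual_pairs K = {{iso_class D, iso_class (dual D)} | D.
     dimonoid D \<and> iso_class D \<in> K \<and> iso_class (dual D) \<in> K \<and>
     iso_class D \<noteq> iso_class (dual D)}"

end

theory Submission
  imports Defs
begin

text \<open>
  A dimonoid of order 3 is isomorphic to one given by a pair of \<open>3 \<times> 3\<close> Cayley tables, and two
  pairs of tables give isomorphic dimonoids iff a permutation of the three labels carries one to
  the other. The classification thus becomes a finite computation, carried out by rewriting: every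
  pair of semigroup tables satisfying the mixed laws is carried to one of 52 listed pairs, no two
  of which are carried to each other. Duality transposes the tables and swaps them, so the list is
  arranged as halves followed by their duals.
\<close>

subsection \<open>Cayley tables\<close>

datatype three = A | B | C

text \<open>Rows and tables are data rather than functions, so that \<open>code_simp\<close> can
  decide their equality by comparing constructors.\<close>

datatype 'b tri = Tri 'b 'b 'b

fun sel :: "'b tri \<Rightarrow> three \<Rightarrow> 'b" where
  "sel (Tri x y z) A = x"
| "sel (Tri x y z) B = y"
| "sel (Tri x y z) C = z"

definition tab :: "(three \<Rightarrow> 'b) \<Rightarrow> 'b tri" where
  "tab f = Tri (f A) (f B) (f C)"

definition all3 :: "(three \<Rightarrow> bool) \<Rightarrow> bool" where
  "all3 P \<longleftrightarrow> P A \<and> P B \<and> P C"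

type_synonym table = "three tri tri"

type_synonym table_pair = "table \<times> table"

abbreviation entry :: "table \<Rightarrow> three \<Rightarrow> three \<Rightarrow> three" where
  "entry t x \<equiv> sel (sel t x)"

abbreviation table_of :: "(three \<Rightarrow> three \<Rightarrow> three) \<Rightarrow> table" where
  "table_of f \<equiv> tab (\<lambda>x. tab (f x))"

definition flip_table :: "table \<Rightarrow> table" where
  "flip_table t = table_of (\<lambda>x y. entry t y x)"

definition dual_pair :: "table_pair \<Rightarrow> table_pair" where
  "dual_pair p = (flip_table (snd p), flip_table (fst p))"

text \<open>The common shape of all five laws: \<open>(x f y) g z = x h (y k z)\<close>. The
  variable \<open>z\<close> is absorbed by comparing whole rows.\<close>

definition mixed_assoc :: "table \<Rightarrow> table \<Rightarrow> table \<Rightarrow> table \<Rightarrow> bool" where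
  "mixed_assoc f g h k \<longleftrightarrow>
     all3 (\<lambda>x. all3 (\<lambda>y. sel g (entry f x y) = tab (\<lambda>z. entry h x (entry k y z))))"

text \<open>The associative laws come last because the pairs that are searched consist of
  semigroup tables: the other laws reject quickly.\<close>

definition dimonoid_pair :: "table_pair \<Rightarrow> bool" where
  "dimonoid_pair p \<longleftrightarrow> (case p of (l, r) \<Rightarrow>
     mixed_assoc l l l r \<and> mixed_assoc r l r l \<and> mixed_assoc l r r r \<and>
     mixed_assoc l l l l \<and> mixed_assoc r r r r)"

definition perms :: "three tri list" where
  "perms = [Tri A B C, Tri A C B, Tri B A C, Tri B C A, Tri C A B, Tri C B A]"

text \<open>The last branch needs no test as long as \<open>s\<close> lists a permutation.\<close>

definition inv3 :: "three tri \<Rightarrow> three \<Rightarrow> three" where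
  "inv3 s y = (if sel s A = y then A else if sel s B = y then B else C)"

text \<open>Transport of structure: for a permutation \<open>s\<close>, the one table that makes
  \<open>s\<close> an isomorphism from \<open>t\<close>.\<close>

definition relabel :: "three tri \<Rightarrow> table \<Rightarrow> table" where
  "relabel s t = table_of (\<lambda>x y. sel s (entry t (inv3 s x) (inv3 s y)))"

definition relabel_pair :: "three tri \<Rightarrow> table_pair \<Rightarrow> table_pair" where
  "relabel_pair s p = (relabel s (fst p), relabel s (snd p))"

definition same_type :: "table_pair \<Rightarrow> table_pair \<Rightarrow> bool" where
  "same_type p q \<longleftrightarrow> list_ex (\<lambda>s. relabel_pair s p = q) perms"

definition abelian_pair :: "table_pair \<Rightarrow> bool" where
  "abelian_pair p \<longleftrightarrow> fst p = flip_table (snd p)"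

definition commutative_pair :: "table_pair \<Rightarrow> bool" where
  "commutative_pair p \<longleftrightarrow> fst p = flip_table (fst p) \<and> snd p = flip_table (snd p)"

definition trivial_pair :: "table_pair \<Rightarrow> bool" where
  "trivial_pair p \<longleftrightarrow> fst p = snd p"

lemma sel_tab [simp]: "sel (tab f) x = f x"
  by (cases x) (simp_all add: tab_def)

lemma all3_iff: "all3 P \<longleftrightarrow> (\<forall>x. P x)"
  unfolding all3_def by (metis three.exhaust)

lemma tri_eq_iff: "s = t \<longleftrightarrow> (\<forall>x. sel s x = sel t x)"
proof
  assume *: "\<forall>x. sel s x = sel t x"
  show "s = t"
    using *[rule_format, of A] *[rule_format, of B] *[rule_format, of C]
    by (cases s; cases t) simp
qed simp

lemma table_eq_iff: "t = u \<longleftrightarrow> (\<forall>x y. entry t x y = entry u x y)"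
  by (simp add: tri_eq_iff)

lemma mixed_assoc_iff:
  "mixed_assoc f g h k \<longleftrightarrow>
    (\<forall>x y z. entry g (entry f x y) z = entry h x (entry k y z))"
  by (simp add: mixed_assoc_def all3_iff tri_eq_iff)

lemma entry_flip_table [simp]: "entry (flip_table t) x y = entry t y x"
  by (simp add: flip_table_def)

lemma flip_table_flip_table [simp]: "flip_table (flip_table t) = t"
  by (simp add: table_eq_iff)

lemma dual_pair_dual_pair [simp]: "dual_pair (dual_pair p) = p"
  by (simp add: dual_pair_def)

lemma UNIV_three: "(UNIV :: three set) = {A, B, C}"
  using three.exhaust by blast

lemma card_three: "finite (UNIV :: three set)" "card (UNIV :: three set) = 3"
  by (simp_all add: UNIV_three)

text \<open>Completeness of \<open>perms\<close>: it lets the search in \<open>same_type\<close>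
  stand for the existence of an arbitrary bijection of the labels.\<close>

lemma tab_in_perms:
  assumes "inj f"
  shows "tab f \<in> set perms"
proof -
  have "f A \<noteq> f B" "f A \<noteq> f C" "f B \<noteq> f C"
    using assms by (auto dest: injD)
  then show ?thesis
    by (cases "f A"; cases "f B"; cases "f C") (simp_all add: tab_def perms_def)
qed

lemma
  assumes "s \<in> set perms"
  shows inv3_sel: "inv3 s (sel s x) = x" and sel_inv3: "sel s (inv3 s x) = x"
  using assms by (cases x; auto simp: perms_def inv3_def)+

lemma bij_sel:
  assumes "s \<in> set perms"
  shows "bij (sel s)"
  using inv3_sel[OF assms] sel_inv3[OF assms] by (intro bijI') metis+

subsection \<open>Representatives\<close>

definition tbl ::
    "three \<Rightarrow> three \<Rightarrow> three \<Rightarrow> three \<Rightarrow> three \<Rightarrow> three \<Rightarrow> three \<Rightarrow> three \<Rightarrow> three \<Rightarrow> table" where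
  "tbl p q r s t u v w x = Tri (Tri p q r) (Tri s t u) (Tri v w x)"

text \<open>The left table suffices, since the abelian law makes the right one its transpose. Such a
  pair is fixed by \<open>dual_pair\<close>, so this block needs no duals.\<close>

definition abel_reps :: "table_pair list" where
  "abel_reps = map (\<lambda>t. (t, flip_table t))
   [tbl A A A A A A C C C,
    tbl A A A A A B A A C,
    tbl A A A A B A C C C,
    tbl A A A A B B A C C,
    tbl A A A B B B C C C]"

text \<open>A null semigroup paired with a nilpotent one whose only nonzero product is that of
  \<open>C\<close> with itself. The tables being symmetric, duality just swaps the
  components.\<close>

definition comm_half :: "table_pair list" where
  "comm_half = [(tbl A A A A A A A A A, tbl A A A A A A A A B)]"

definition non_half :: "table_pair list" where
  "non_half =
   [(tbl A A A A A A A A A, tbl A A C A A C A A C),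
    (tbl A A A A A A A A A, tbl A B B A B B A B B),
    (tbl A A A A A A A A A, tbl A B C A B C A B C),
    (tbl A A A A A A A A C, tbl A A A A A A A B C),
    (tbl A A A A A A A A C, tbl A B A A B A A B C),
    (tbl A A A A A A C C C, tbl A B C A B C A B C),
    (tbl A A A A A B A A C, tbl A B A A B A A B C),
    (tbl A A A A A B A A C, tbl A B B A B B A B C),
    (tbl A A A A B B A B B, tbl A A A A B C A B C),
    (tbl A A A B B B C C C, tbl A A A A A A C C C)]"

text \<open>Interchanging \<open>B\<close> and \<open>C\<close> carries the dual of this pair back
  to the pair.\<close>

definition self_dual_reps :: "table_pair list" where
  "self_dual_reps = [(tbl A A A A A A C C C, tbl A B A A B A A B A)]"

text \<open>With equal components every law reduces to associativity, so this block and the next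
  list semigroups. Duality passes to the opposite semigroup, which for a commutative one is no
  change.\<close>

definition triv_comm_reps :: "table_pair list" where
  "triv_comm_reps = map (\<lambda>t. (t, t))
   [tbl A A A A A A A A A,
    tbl A A A A A A A A B,
    tbl A A A A A A A A C,
    tbl A A A A A B A B C,
    tbl A A A A B A A A C,
    tbl A A A A B B A B B,
    tbl A A A A B B A B C,
    tbl A A A A B C A C B,
    tbl A A C A A C C C A,
    tbl A A C A B C C C A,
    tbl A B B B A A B A A,
    tbl A B C B C A C A B]"

definition triv_non_half :: "table_pair list" where
  "triv_non_half = map (\<lambda>t. (t, t))
   [tbl A A A A A A A B C,
    tbl A A A A A A C C C,
    tbl A A A A B A C C C,
    tbl A A A A B B A C C,
    tbl A A A A B C C C C,
    tbl A A A B B B C C C]"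

definition comm_reps :: "table_pair list" where
  "comm_reps = comm_half @ map dual_pair comm_half"

definition non_reps :: "table_pair list" where
  "non_reps = non_half @ map dual_pair non_half @ self_dual_reps"

definition triv_non_reps :: "table_pair list" where
  "triv_non_reps = triv_non_half @ map dual_pair triv_non_half"

definition reps :: "table_pair list" where
  "reps = abel_reps @ comm_reps @ non_reps @ triv_comm_reps @ triv_non_reps"

section \<open>Computations on the list of representatives\<close>

lemma length_reps:
  "length reps = 52" "length abel_reps = 5" "length comm_reps = 2" "length non_half = 10"
  "length non_reps = 21" "length self_dual_reps = 1" "length triv_comm_reps = 12"
  "length triv_non_half = 6" "length triv_non_reps = 12"
  by code_simp+

lemma distinct_reps: "distinct reps"
  by code_simp

lemma list_all_dimonoid_pair_reps: "list_all dimonoid_pair reps"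
  by code_simp

text \<open>The uniqueness half of the classification: together with \<open>distinct_reps\<close> it
  excludes two entries of the same type.\<close>

lemma reps_irredundant:
  "list_all (\<lambda>p. list_all (\<lambda>s. relabel_pair s p = p \<or> relabel_pair s p \<notin> set reps) perms) reps"
  by code_simp

text \<open>Each block is characterised by a property, which is how the isomorphism classes are
  selected. Equality even as lists is possible because \<open>reps\<close> concatenates the
  blocks.\<close>

lemma filter_reps:
  "filter (\<lambda>p. abelian_pair p \<and> \<not> trivial_pair p) reps = abel_reps"
  "filter (\<lambda>p. commutative_pair p \<and> \<not> trivial_pair p) reps = comm_reps"
  "filter (\<lambda>p. \<not> abelian_pair p \<and> \<not> commutative_pair p \<and> \<not> trivial_pair p) reps = non_reps"
  "filter (\<lambda>p. \<not> abelian_pair p \<and> \<not> commutative_pair p \<and> \<not> trivial_pair p \<and>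
     same_type p (dual_pair p)) reps = self_dual_reps"
  "filter (\<lambda>p. commutative_pair p \<and> trivial_pair p) reps = triv_comm_reps"
  "filter (\<lambda>p. \<not> commutative_pair p \<and> trivial_pair p) reps = triv_non_reps"
  by code_simp+

lemma same_type_repsD:
  assumes "p \<in> set reps" "q \<in> set reps" "same_type p q"
  shows "p = q"
  using assms reps_irredundant unfolding same_type_def list_all_iff list_ex_iff by metis

section \<open>Exhaustive search over pairs of semigroup tables\<close>

definition rows :: "three tri list" where
  "rows = [Tri x y z. x \<leftarrow> [A, B, C], y \<leftarrow> [A, B, C], z \<leftarrow> [A, B, C]]"

text \<open>Associativity, as far as it can be decided from the rows in \<open>xs\<close>; it prunes the search
  for semigroup tables.\<close>

definition assoc_within :: "three list \<Rightarrow> table \<Rightarrow> bool" where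
  "assoc_within xs t \<longleftrightarrow> list_all (\<lambda>x. list_all (\<lambda>y.
     entry t x y \<in> set xs \<longrightarrow>
     sel t (entry t x y) = tab (\<lambda>z. entry t x (entry t y z))) xs) xs"

text \<open>Rows not chosen yet are filled with copies of earlier ones; the result of
  \<open>assoc_within\<close> does not depend on rows outside its list.\<close>

definition semigroup_tables :: "table list" where
  "semigroup_tables = [Tri r s t.
     r \<leftarrow> rows, assoc_within [A] (Tri r r r),
     s \<leftarrow> rows, assoc_within [A, B] (Tri r s s),
     t \<leftarrow> rows, mixed_assoc (Tri r s t) (Tri r s t) (Tri r s t) (Tri r s t)]"

lemma in_rows: "r \<in> set rows"
proof (cases r)
  case (Tri x y z)
  then show ?thesis
    by (cases x; cases y; cases z) (simp_all add: rows_def)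
qed

text \<open>Pruning loses no semigroup: each partial check is an instance of full associativity, and
  its guard restricts it to rows already fixed.\<close>

lemma in_semigroup_tables:
  assumes "mixed_assoc u u u u"
  shows "u \<in> set semigroup_tables"
proof (cases u)
  case (Tri r s t)
  have assoc: "sel u (entry u x y) = tab (\<lambda>z. entry u x (entry u y z))" for x y
    using assms by (simp add: mixed_assoc_iff tri_eq_iff)
  have "assoc_within [A] (Tri r r r)"
    using assoc[of A A] Tri by (auto simp: assoc_within_def)
  moreover have "assoc_within [A, B] (Tri r s s)"
    using assoc[of A A] assoc[of A B] assoc[of B A] assoc[of B B] Tri
    by (auto simp: assoc_within_def)
  ultimately show ?thesis
    using assms Tri by (auto simp: semigroup_tables_def in_rows)
qed

text \<open>Testing membership computes each relabelling once, instead of once per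
  representative.\<close>

definition covered :: "table_pair \<Rightarrow> bool" where
  "covered p \<longleftrightarrow> list_ex (\<lambda>s. relabel_pair s p \<in> set reps) perms"

text \<open>The existence half of the classification, settled by evaluation.\<close>

lemma semigroup_tables_covered:
  "list_all (\<lambda>l. list_all (\<lambda>r. \<not> dimonoid_pair (l, r) \<or> covered (l, r)) semigroup_tables)
     semigroup_tables"
  by code_simp

lemma dimonoid_pair_covered:
  assumes "dimonoid_pair p"
  obtains q where "q \<in> set reps" "same_type p q"
proof -
  obtain l r where p: "p = (l, r)" by fastforce
  with assms have "l \<in> set semigroup_tables" "r \<in> set semigroup_tables"
    by (auto simp: dimonoid_pair_def intro: in_semigroup_tables)
  with assms semigroup_tables_covered p have "covered p"
    by (auto simp: list_all_iff)
  then show thesis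
    using that unfolding covered_def same_type_def list_ex_iff by blast
qed

subsection \<open>Isomorphisms of dimonoids\<close>

lemma isomorphic_iff:
  "isomorphic D E \<longleftrightarrow> (\<exists>h. bij_betw h (carrier D) (carrier E) \<and>
     (\<forall>x\<in>carrier D. \<forall>y\<in>carrier D.
        h (x \<stileturn>\<^bsub>D\<^esub> y) = h x \<stileturn>\<^bsub>E\<^esub> h y \<and> h (x \<turnstile>\<^bsub>D\<^esub> y) = h x \<turnstile>\<^bsub>E\<^esub> h y))"
  unfolding isomorphic_def dimonoid_iso_def by blast

lemma isomorphicI:
  assumes "bij_betw h (carrier D) (carrier E)"
    and "\<And>x y. x \<in> carrier D \<Longrightarrow> y \<in> carrier D \<Longrightarrow>
      h (x \<stileturn>\<^bsub>D\<^esub> y) = h x \<stileturn>\<^bsub>E\<^esub> h y"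
    and "\<And>x y. x \<in> carrier D \<Longrightarrow> y \<in> carrier D \<Longrightarrow>
      h (x \<turnstile>\<^bsub>D\<^esub> y) = h x \<turnstile>\<^bsub>E\<^esub> h y"
  shows "isomorphic D E"
  using assms unfolding isomorphic_iff by blast

lemma isomorphic_refl: "isomorphic D D"
  by (rule isomorphicI[of id]) auto

lemma isomorphic_trans:
  assumes "isomorphic D E" "isomorphic E F"
  shows "isomorphic D F"
proof -
  obtain g where g: "bij_betw g (carrier D) (carrier E)"
    "\<And>x y. x \<in> carrier D \<Longrightarrow> y \<in> carrier D \<Longrightarrow> g (x \<stileturn>\<^bsub>D\<^esub> y) = g x \<stileturn>\<^bsub>E\<^esub> g y"
    "\<And>x y. x \<in> carrier D \<Longrightarrow> y \<in> carrier D \<Longrightarrow> g (x \<turnstile>\<^bsub>D\<^esub> y) = g x \<turnstile>\<^bsub>E\<^esub> g y"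
    using assms(1) unfolding isomorphic_iff by blast
  obtain h where h: "bij_betw h (carrier E) (carrier F)"
    "\<And>x y. x \<in> carrier E \<Longrightarrow> y \<in> carrier E \<Longrightarrow> h (x \<stileturn>\<^bsub>E\<^esub> y) = h x \<stileturn>\<^bsub>F\<^esub> h y"
    "\<And>x y. x \<in> carrier E \<Longrightarrow> y \<in> carrier E \<Longrightarrow> h (x \<turnstile>\<^bsub>E\<^esub> y) = h x \<turnstile>\<^bsub>F\<^esub> h y"
    using assms(2) unfolding isomorphic_iff by blast
  show ?thesis
    using bij_betw_trans[OF g(1) h(1)] g h bij_betwE[OF g(1)]
    by (intro isomorphicI[of "h \<circ> g"]) auto
qed

context dimonoid
begin

text \<open>\<open>D1\<close> in a form that fits right-nested normal forms: used beside
  \<open>left_assoc\<close> as a rewrite rule, it brings both sides of \<open>D1\<close> to the same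
  term.\<close>

lemma left_mult_right:
  assumes "x \<in> carrier D" "y \<in> carrier D" "z \<in> carrier D"
  shows "x \<stileturn> (y \<turnstile> z) = x \<stileturn> (y \<stileturn> z)"
  using assms D1 left_assoc by metis

text \<open>Closure of \<open>D\<close> enters here: the inverse map undoes \<open>h\<close> only on
  the carrier, so products must stay inside it.\<close>

lemma isomorphic_sym:
  assumes "isomorphic D E"
  shows "isomorphic E D"
proof -
  obtain h where h: "bij_betw h (carrier D) (carrier E)"
    "\<And>x y. x \<in> carrier D \<Longrightarrow> y \<in> carrier D \<Longrightarrow> h (x \<stileturn> y) = h x \<stileturn>\<^bsub>E\<^esub> h y"
    "\<And>x y. x \<in> carrier D \<Longrightarrow> y \<in> carrier D \<Longrightarrow> h (x \<turnstile> y) = h x \<turnstile>\<^bsub>E\<^esub> h y"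
    using assms unfolding isomorphic_iff by blast
  let ?g = "the_inv_into (carrier D) h"
  have inj: "inj_on h (carrier D)" and img: "carrier E = h ` carrier D"
    using h(1) by (auto simp: bij_betw_def)
  show ?thesis
  proof (rule isomorphicI[of ?g])
    show "bij_betw ?g (carrier E) (carrier D)"
      using h(1) by (rule bij_betw_the_inv_into)
  qed (auto simp: img the_inv_into_f_f[OF inj] left_closed right_closed h(2,3)[symmetric])
qed

lemma isomorphic_transfer:
  assumes "isomorphic D E"
  shows dimonoid_isomorphic: "dimonoid E"
    and abelian_isomorphic: "abelian D \<longleftrightarrow> abelian E"
    and commutative_isomorphic: "commutative D \<longleftrightarrow> commutative E"
    and trivial_isomorphic: "trivial D \<longleftrightarrow> trivial E"
proof -
  obtain h where h: "bij_betw h (carrier D) (carrier E)"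
    "\<And>x y. x \<in> carrier D \<Longrightarrow> y \<in> carrier D \<Longrightarrow> h (x \<stileturn> y) = h x \<stileturn>\<^bsub>E\<^esub> h y"
    "\<And>x y. x \<in> carrier D \<Longrightarrow> y \<in> carrier D \<Longrightarrow> h (x \<turnstile> y) = h x \<turnstile>\<^bsub>E\<^esub> h y"
    using assms unfolding isomorphic_iff by blast
  have inj: "\<And>x y. x \<in> carrier D \<Longrightarrow> y \<in> carrier D \<Longrightarrow> h x = h y \<longleftrightarrow> x = y"
    and img: "carrier E = h ` carrier D"
    using h(1) by (auto simp: bij_betw_def dest: inj_onD)
  \<comment> \<open>Elements of \<open>E\<close> are written as images under \<open>h\<close>; the
    reversed homomorphism laws then collect each product in \<open>E\<close> into the image of a
    product in \<open>D\<close>.\<close>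
  note hom = h(2,3)[symmetric]
  show "dimonoid E"
    by unfold_locales
      (auto simp: img hom left_closed right_closed left_assoc right_assoc left_mult_right D2 D3)
  show "abelian D \<longleftrightarrow> abelian E" "commutative D \<longleftrightarrow> commutative E"
    "trivial D \<longleftrightarrow> trivial E"
    by (simp_all add: abelian_def commutative_def trivial_def img hom inj left_closed right_closed)
qed

text \<open>Reversing the factors and exchanging the operations exchanges \<open>D1\<close> with
  \<open>D3\<close> and the two associative laws, and maps \<open>D2\<close> to itself.\<close>

lemma dimonoid_dual: "dimonoid (dual D)"
  by unfold_locales
    (auto simp: dual_def left_closed right_closed left_assoc right_assoc left_mult_right D2 D3)

end

section \<open>Duality and isomorphism classes\<close>

lemma isomorphic_dual:
  assumes "isomorphic D E"
  shows "isomorphic (dual D) (dual E)"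
  using assms unfolding isomorphic_iff by (auto simp: dual_def)

lemma iso_dual_isomorphic:
  assumes "dimonoid D" "isomorphic D E"
  shows "iso_dual D \<longleftrightarrow> iso_dual E"
proof -
  interpret D: dimonoid D by fact
  note ED = D.isomorphic_sym[OF assms(2)]
  show ?thesis
    unfolding iso_dual_def
  proof
    assume "isomorphic D (dual D)"
    from isomorphic_trans[OF isomorphic_trans[OF ED this] isomorphic_dual[OF assms(2)]]
    show "isomorphic E (dual E)" .
  next
    assume "isomorphic E (dual E)"
    from isomorphic_trans[OF isomorphic_trans[OF assms(2) this] isomorphic_dual[OF ED]]
    show "isomorphic D (dual D)" .
  qed
qed

lemma iso_class_eq_iff:
  assumes "dimonoid D" "dimonoid E"
  shows "iso_class D = iso_class E \<longleftrightarrow> isomorphic D E"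
proof
  assume "iso_class D = iso_class E"
  then show "isomorphic D E"
    using assms isomorphic_refl unfolding iso_class_def by blast
next
  assume "isomorphic D E"
  moreover have "isomorphic E D"
    using assms(1) calculation by (rule dimonoid.isomorphic_sym)
  ultimately show "iso_class D = iso_class E"
    using isomorphic_trans unfolding iso_class_def by blast
qed

subsection \<open>Dimonoids with a given Cayley table\<close>

text \<open>The classes consist of dimonoids on subsets of the fixed type \<open>'a\<close>, so the
  labels are embedded there and all models share the carrier \<open>range e\<close>.\<close>

locale labelling =
  fixes e :: "three \<Rightarrow> 'a"
  assumes inj_e: "inj e"
begin

lemma inv_e [simp]: "inv e (e x) = x"
  using inj_e by simp

lemma e_eq_iff [simp]: "e x = e y \<longleftrightarrow> x = y"
  using inj_e by (simp add: inj_eq)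

definition model :: "table_pair \<Rightarrow> 'a bimagma" where
  "model p = \<lparr>carrier = range e,
     left_op = (\<lambda>x y. e (entry (fst p) (inv e x) (inv e y))),
     right_op = (\<lambda>x y. e (entry (snd p) (inv e x) (inv e y)))\<rparr>"

lemma model_simps [simp]:
  "carrier (model p) = range e"
  "left_op (model p) x y = e (entry (fst p) (inv e x) (inv e y))"
  "right_op (model p) x y = e (entry (snd p) (inv e x) (inv e y))"
  by (simp_all add: model_def)

lemma dimonoid_model_iff: "dimonoid (model p) \<longleftrightarrow> dimonoid_pair p"
proof
  assume "dimonoid (model p)"
  then interpret D: dimonoid "model p" .
  show "dimonoid_pair p"
    using D.left_assoc[of "e _" "e _" "e _"] D.right_assoc[of "e _" "e _" "e _"]
      D.D1[of "e _" "e _" "e _"] D.D2[of "e _" "e _" "e _"] D.D3[of "e _" "e _" "e _"]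
    by (simp add: dimonoid_pair_def mixed_assoc_iff split_beta)
next
  assume "dimonoid_pair p"
  then show "dimonoid (model p)"
    by unfold_locales (auto simp: dimonoid_pair_def mixed_assoc_iff split_beta)
qed

text \<open>An equality of records, not merely an isomorphism: the defining formulas also agree off
  the carrier.\<close>

lemma dual_model: "dual (model p) = model (dual_pair p)"
  by (simp add: dual_def model_def dual_pair_def)

lemma abelian_model_iff: "abelian (model p) \<longleftrightarrow> abelian_pair p"
  by (auto simp: abelian_def abelian_pair_def table_eq_iff)

lemma commutative_model_iff: "commutative (model p) \<longleftrightarrow> commutative_pair p"
  by (auto simp: commutative_def commutative_pair_def table_eq_iff)

lemma trivial_model_iff: "trivial (model p) \<longleftrightarrow> trivial_pair p"
  by (auto simp: trivial_def trivial_pair_def table_eq_iff)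

lemma isomorphic_model_iff: "isomorphic (model p) (model q) \<longleftrightarrow> same_type p q"
proof
  assume "same_type p q"
  then obtain s where s: "s \<in> set perms" and q: "q = relabel_pair s p"
    by (auto simp: same_type_def list_ex_iff)
  \<comment> \<open>The permutation of the labels acts on the carrier by conjugation with
    \<open>e\<close>.\<close>
  have inj: "inj_on (e \<circ> sel s \<circ> inv e) (range e)"
    using bij_sel[OF s] by (auto simp: inj_on_def bij_def)
  have img: "(e \<circ> sel s \<circ> inv e) ` range e = range e"
  proof -
    have "(e \<circ> sel s \<circ> inv e) ` range e = e ` range (sel s)"
      by (simp add: image_image)
    also have "\<dots> = range e"
      using bij_sel[OF s] by (simp add: bij_def)
    finally show ?thesis .
  qed
  show "isomorphic (model p) (model q)"
    using inj img
    by (intro isomorphicI[of "e \<circ> sel s \<circ> inv e"])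
      (auto simp: bij_betw_def q relabel_pair_def relabel_def inv3_sel[OF s])
next
  assume "isomorphic (model p) (model q)"
  then obtain h where h: "bij_betw h (range e) (range e)"
    "\<And>x y. h (e (entry (fst p) x y)) = e (entry (fst q) (inv e (h (e x))) (inv e (h (e y))))"
    "\<And>x y. h (e (entry (snd p) x y)) = e (entry (snd q) (inv e (h (e x))) (inv e (h (e y))))"
    unfolding isomorphic_iff by auto
  \<comment> \<open>The isomorphism read as a permutation of the labels.\<close>
  define g where "g = inv e \<circ> h \<circ> e"
  have he: "h (e x) = e (g x)" for x
    using bij_betwE[OF h(1)] by (auto simp: g_def f_inv_into_f)
  have "inj g"
  proof (rule injI)
    fix x y
    assume "g x = g y"
    then have "h (e x) = h (e y)" by (simp add: he)
    then show "x = y" using h(1) by (auto simp: bij_betw_def dest: inj_onD)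
  qed
  then have s: "tab g \<in> set perms" by (rule tab_in_perms)
  have "g (entry (fst p) x y) = entry (fst q) (g x) (g y)"
    "g (entry (snd p) x y) = entry (snd q) (g x) (g y)" for x y
    using h(2,3)[of x y] by (simp_all add: he)
  then have "relabel_pair (tab g) p = q"
    using sel_inv3[OF s] by (simp add: relabel_pair_def relabel_def prod_eq_iff table_eq_iff)
  with s show "same_type p q" by (auto simp: same_type_def list_ex_iff)
qed

lemma iso_dual_model_iff: "iso_dual (model p) \<longleftrightarrow> same_type p (dual_pair p)"
  by (simp add: iso_dual_def dual_model isomorphic_model_iff)

lemma dimonoid_of_order_model:
  assumes "p \<in> set reps"
  shows "dimonoid_of_order 3 (model p)"
  using assms list_all_dimonoid_pair_reps card_three inj_e
  by (simp add: dimonoid_of_order_def dimonoid_model_iff list_all_iff card_image)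

lemma ex_isomorphic_model:
  fixes D :: "'a bimagma"
  assumes "dimonoid_of_order 3 D"
  obtains p where "p \<in> set reps" "isomorphic D (model p)"
proof -
  interpret D: dimonoid D using assms by (simp add: dimonoid_of_order_def)
  obtain g :: "three \<Rightarrow> 'a" where g: "bij_betw g UNIV (carrier D)"
    using assms card_three finite_same_card_bij
    unfolding dimonoid_of_order_def by metis
  have inj: "inj g" and img: "carrier D = range g"
    using g by (auto simp: bij_betw_def)
  \<comment> \<open>The tables of \<open>D\<close> with its elements named by \<open>g\<close>. The
    choice of \<open>g\<close> is immaterial, since \<open>p\<close> is only needed up to
    relabelling.\<close>
  define p where "p = (table_of (\<lambda>x y. inv g (g x \<stileturn>\<^bsub>D\<^esub> g y)),
    table_of (\<lambda>x y. inv g (g x \<turnstile>\<^bsub>D\<^esub> g y)))"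
  have "isomorphic D (model p)"
  proof (rule isomorphicI[of "e \<circ> inv g"])
    show "bij_betw (e \<circ> inv g) (carrier D) (carrier (model p))"
      using bij_betw_trans[OF bij_betw_inv_into[OF g], of e "range e"] inj_e
      by (simp add: inj_on_imp_bij_betw)
  qed (auto simp: img inj p_def)
  moreover from this have "dimonoid_pair p"
    using D.dimonoid_isomorphic dimonoid_model_iff by blast
  then obtain q where "q \<in> set reps" "same_type p q"
    by (rule dimonoid_pair_covered)
  ultimately show thesis
    using that isomorphic_model_iff isomorphic_trans by blast
qed

section \<open>Counting isomorphism classes and dual pairs\<close>

definition cls :: "table_pair \<Rightarrow> 'a bimagma set" where
  "cls p = iso_class (model p)"

lemma dimonoid_model:
  assumes "p \<in> set reps"
  shows "dimonoid (model p)"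
  using dimonoid_of_order_model[OF assms] by (simp add: dimonoid_of_order_def)

text \<open>Equal classes mean tables of the same type, hence equal entries of \<open>reps\<close>.
  Counting classes thus becomes counting list entries.\<close>

lemma inj_on_cls: "inj_on cls (set reps)"
  by (rule inj_onI, rule same_type_repsD)
    (simp_all add: cls_def iso_class_eq_iff dimonoid_model isomorphic_model_iff)

lemma card_cls:
  assumes "distinct ps" "set ps \<subseteq> set reps"
  shows "card (cls ` set ps) = length ps"
  using assms inj_on_cls by (simp add: card_image inj_on_subset distinct_card)

text \<open>The assumption lets \<open>Q\<close> decide \<open>P\<close> on tables. Applied to a
  dimonoid and its representative it gives one inclusion, applied to a model and itself the
  other.\<close>

lemma iso_classes_eq:
  assumes "\<And>D p. dimonoid D \<Longrightarrow> isomorphic D (model p) \<Longrightarrow> P D \<longleftrightarrow> Q p"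
  shows "iso_classes 3 P = cls ` set (filter Q reps)"
proof (intro equalityI subsetI)
  fix X
  assume "X \<in> iso_classes 3 P"
  then obtain D where D: "dimonoid_of_order 3 D" "P D" "X = iso_class D"
    by (auto simp: iso_classes_def)
  then have "dimonoid D" by (simp add: dimonoid_of_order_def)
  obtain p where p: "p \<in> set reps" "isomorphic D (model p)"
    using D(1) by (rule ex_isomorphic_model)
  then have "Q p" "X = cls p"
    using D \<open>dimonoid D\<close> assms by (auto simp: cls_def iso_class_eq_iff dimonoid_model)
  with p show "X \<in> cls ` set (filter Q reps)" by auto
next
  fix X
  assume "X \<in> cls ` set (filter Q reps)"
  then obtain p where "p \<in> set reps" "Q p" "X = cls p" by auto
  then show "X \<in> iso_classes 3 P"
    using assms[of "model p" p] dimonoid_of_order_model dimonoid_model isomorphic_refl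
    unfolding iso_classes_def cls_def by blast
qed

text \<open>Meant for a block made of a half \<open>ps\<close>, its duals and self-dual entries
  \<open>ss\<close>. Dualising a class dualises its tables, so each dual pair is met exactly once in
  \<open>ps\<close>, and \<open>ss\<close> contributes none.\<close>

lemma dual_pairs_cls:
  assumes reps: "set ps \<union> dual_pair ` set ps \<union> set ss \<subseteq> set reps"
    and distinct: "distinct (ps @ map dual_pair ps)"
    and self_dual: "\<And>s. s \<in> set ss \<Longrightarrow> same_type s (dual_pair s)"
  defines "K \<equiv> cls ` set (ps @ map dual_pair ps @ ss)"
  shows "dual_pairs K = (\<lambda>p. {cls p, cls (dual_pair p)}) ` set ps"
    and "card (dual_pairs K) = length ps"
proof -
  show eq: "dual_pairs K = (\<lambda>p. {cls p, cls (dual_pair p)}) ` set ps"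
  proof (intro equalityI subsetI)
    fix X
    assume "X \<in> dual_pairs K"
    then obtain D where D: "dimonoid D" "iso_class D \<in> K" "iso_class D \<noteq> iso_class (dual D)"
      and X: "X = {iso_class D, iso_class (dual D)}"
      by (auto simp: dual_pairs_def)
    then obtain p where p: "p \<in> set ps \<union> dual_pair ` set ps \<union> set ss" "iso_class D = cls p"
      by (auto simp: K_def)
    then have "p \<in> set reps" using reps by auto
    then have "isomorphic D (model p)"
      using p D(1) by (simp add: cls_def iso_class_eq_iff dimonoid_model)
    then have dual: "iso_class (dual D) = cls (dual_pair p)"
      using isomorphic_dual[of D "model p"] D(1) dimonoid_model[OF \<open>p \<in> set reps\<close>]
      by (simp add: cls_def iso_class_eq_iff dimonoid.dimonoid_dual flip: dual_model)
    have "p \<notin> set ss"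
    proof
      assume "p \<in> set ss"
      then have "isomorphic (model p) (dual (model p))"
        using self_dual by (simp add: dual_model isomorphic_model_iff)
      then have "cls p = cls (dual_pair p)"
        using dimonoid_model[OF \<open>p \<in> set reps\<close>]
        by (simp add: cls_def iso_class_eq_iff dimonoid.dimonoid_dual flip: dual_model)
      then show False using D(3) p(2) dual by simp
    qed
    \<comment> \<open>An entry of the dual half yields the same unordered pair as its partner in
      \<open>ps\<close>, because \<open>dual_pair\<close> is an involution.\<close>
    with p(1) show "X \<in> (\<lambda>p. {cls p, cls (dual_pair p)}) ` set ps"
      by (auto simp: X p(2) dual)
  next
    fix X
    assume "X \<in> (\<lambda>p. {cls p, cls (dual_pair p)}) ` set ps"
    then obtain p where p: "p \<in> set ps" and X: "X = {cls p, cls (dual_pair p)}" by auto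
    have "p \<notin> dual_pair ` set ps" using p distinct by auto
    then have "p \<noteq> dual_pair p" using p by (metis imageI)
    then have "cls p \<noteq> cls (dual_pair p)"
      using p reps inj_onD[OF inj_on_cls, of p "dual_pair p"] by auto
    moreover have "cls p \<in> K" "cls (dual_pair p) \<in> K"
      using p by (auto simp: K_def)
    moreover have "iso_class (dual (model p)) = cls (dual_pair p)" "dimonoid (model p)"
      using p reps dimonoid_model[of p] by (auto simp: cls_def dual_model)
    ultimately show "X \<in> dual_pairs K"
      unfolding dual_pairs_def X
      by (intro CollectI exI[of _ "model p"]) (simp add: cls_def[of p])
  qed
  have "inj_on (\<lambda>p. {cls p, cls (dual_pair p)}) (set ps)"
  proof (rule inj_onI)
    fix p q
    assume pq: "p \<in> set ps" "q \<in> set ps"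
      and "{cls p, cls (dual_pair p)} = {cls q, cls (dual_pair q)}"
    then have "cls p = cls q \<or> cls p = cls (dual_pair q)"
      by (auto simp: doubleton_eq_iff)
    then have "p = q \<or> p = dual_pair q"
      using pq reps inj_onD[OF inj_on_cls, of p q] inj_onD[OF inj_on_cls, of p "dual_pair q"]
      by auto
    \<comment> \<open>The alternative \<open>p = dual_pair q\<close> would put \<open>p\<close> in
      both halves.\<close>
    then show "p = q" using pq distinct by auto
  qed
  then show "card (dual_pairs K) = length ps"
    unfolding eq using distinct by (simp add: card_image distinct_card)
qed

end

section \<open>Assembling the classification\<close>

theorem theorem4p4:
  fixes All Abel Comm Non TrivC TrivN IsoDual :: "'a bimagma set set"
  assumes three_elements: "\<exists>S :: 'a set. card S = 3"
    and All: "All = iso_classes 3 (\<lambda>D. True)"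
    and Abel: "Abel = iso_classes 3 (\<lambda>D. abelian D \<and> \<not> trivial D)"
    and Comm: "Comm = iso_classes 3 (\<lambda>D. commutative D \<and> \<not> trivial D)"
    and Non: "Non = iso_classes 3 (\<lambda>D. \<not> abelian D \<and> \<not> commutative D \<and> \<not> trivial D)"
    and IsoDual: "IsoDual =
      iso_classes 3 (\<lambda>D. \<not> abelian D \<and> \<not> commutative D \<and> \<not> trivial D \<and> iso_dual D)"
    and TrivC: "TrivC = iso_classes 3 (\<lambda>D. commutative D \<and> trivial D)"
    and TrivN: "TrivN = iso_classes 3 (\<lambda>D. \<not> commutative D \<and> trivial D)"
  shows "card All = 52 \<and>
    partition_on All {Abel, Comm, Non, TrivC, TrivN} \<and>
    card Abel = 5 \<and>
    (card Comm = 2 \<and> dual_pairs Comm = {Comm}) \<and>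
    (card Non = 21 \<and> card (dual_pairs Non) = 10 \<and> card IsoDual = 1 \<and>
      Non = \<Union> (dual_pairs Non) \<union> IsoDual) \<and>
    (card TrivC = 12 \<and>
      (\<forall>D :: 'a bimagma. dimonoid_of_order 3 D \<and> trivial D \<longrightarrow> (commutative D \<longleftrightarrow> abelian D))) \<and>
    (card TrivN = 12 \<and> card (dual_pairs TrivN) = 6 \<and> TrivN = \<Union> (dual_pairs TrivN))"
proof -
  obtain S :: "'a set" where S: "card S = 3"
    using three_elements by blast
  then have "finite S" using card.infinite by fastforce
  then obtain e :: "three \<Rightarrow> 'a" where "bij_betw e UNIV S"
    using S card_three finite_same_card_bij by metis
  then interpret labelling e
    by unfold_locales (simp add: bij_betw_def)
  \<comment> \<open>These carry each property from \<open>D\<close> to its model by isomorphism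
    invariance, and from the model to its tables.\<close>
  note transfer = dimonoid.abelian_isomorphic dimonoid.commutative_isomorphic
    dimonoid.trivial_isomorphic iso_dual_isomorphic
    abelian_model_iff commutative_model_iff trivial_model_iff iso_dual_model_iff
  have all: "All = cls ` set reps"
    unfolding All by (subst iso_classes_eq[where Q = "\<lambda>_. True"]) auto
  have abel: "Abel = cls ` set abel_reps"
    unfolding Abel filter_reps[symmetric] by (rule iso_classes_eq) (simp add: transfer)
  have comm: "Comm = cls ` set comm_reps"
    unfolding Comm filter_reps[symmetric] by (rule iso_classes_eq) (simp add: transfer)
  have non: "Non = cls ` set non_reps"
    unfolding Non filter_reps(3)[symmetric] by (rule iso_classes_eq) (simp add: transfer)
  have iso_dual: "IsoDual = cls ` set self_dual_reps"
    unfolding IsoDual filter_reps(4)[symmetric] by (rule iso_classes_eq) (simp add: transfer)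
  have trivC: "TrivC = cls ` set triv_comm_reps"
    unfolding TrivC filter_reps[symmetric] by (rule iso_classes_eq) (simp add: transfer)
  have trivN: "TrivN = cls ` set triv_non_reps"
    unfolding TrivN filter_reps[symmetric] by (rule iso_classes_eq) (simp add: transfer)

  have sub: "set abel_reps \<subseteq> set reps" "set comm_reps \<subseteq> set reps" "set non_reps \<subseteq> set reps"
    "set self_dual_reps \<subseteq> set reps" "set triv_comm_reps \<subseteq> set reps"
    "set triv_non_reps \<subseteq> set reps"
    by (auto simp: reps_def non_reps_def)
  have dist: "distinct abel_reps" "distinct comm_reps" "distinct non_reps"
    "distinct triv_comm_reps" "distinct triv_non_reps"
    using distinct_reps by (simp_all add: reps_def)
  have dist': "distinct self_dual_reps"
    using dist(3) by (simp add: non_reps_def)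
  have cards: "card All = 52" "card Abel = 5" "card Comm = 2" "card Non = 21"
    "card IsoDual = 1" "card TrivC = 12" "card TrivN = 12"
    unfolding all abel comm non iso_dual trivC trivN
    using card_cls[OF distinct_reps order_refl] card_cls[OF dist(1) sub(1)]
      card_cls[OF dist(2) sub(2)] card_cls[OF dist(3) sub(3)] card_cls[OF dist' sub(4)]
      card_cls[OF dist(4) sub(5)] card_cls[OF dist(5) sub(6)]
    by (simp_all only: length_reps)

  have self_dual: "same_type s (dual_pair s)" if "s \<in> set self_dual_reps" for s
    using that unfolding filter_reps(4)[symmetric] by simp
  note comm_dual_pairs = dual_pairs_cls[of comm_half "[]", unfolded append_Nil2]
  note non_dual_pairs = dual_pairs_cls[of non_half self_dual_reps]
  note triv_dual_pairs = dual_pairs_cls[of triv_non_half "[]", unfolded append_Nil2]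
  have comm_pairs: "dual_pairs Comm = (\<lambda>p. {cls p, cls (dual_pair p)}) ` set comm_half"
    unfolding comm comm_reps_def
    by (rule comm_dual_pairs; use sub(2) dist(2) in \<open>simp add: comm_reps_def\<close>)
  have non_pairs: "dual_pairs Non = (\<lambda>p. {cls p, cls (dual_pair p)}) ` set non_half"
    unfolding non non_reps_def
    by (rule non_dual_pairs; use sub(3) dist(3) self_dual in \<open>auto simp: non_reps_def\<close>)
  have triv_pairs: "dual_pairs TrivN = (\<lambda>p. {cls p, cls (dual_pair p)}) ` set triv_non_half"
    unfolding trivN triv_non_reps_def
    by (rule triv_dual_pairs; use sub(6) dist(5) in \<open>simp add: triv_non_reps_def\<close>)
  have "card (dual_pairs Non) = length non_half"
    unfolding non non_reps_def
    by (rule non_dual_pairs; use sub(3) dist(3) self_dual in \<open>auto simp: non_reps_def\<close>)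
  moreover have "card (dual_pairs TrivN) = length triv_non_half"
    unfolding trivN triv_non_reps_def
    by (rule triv_dual_pairs; use sub(6) dist(5) in \<open>simp add: triv_non_reps_def\<close>)
  ultimately have card_pairs: "card (dual_pairs Non) = 10" "card (dual_pairs TrivN) = 6"
    by (simp_all only: length_reps)
  \<comment> \<open>Injectivity of \<open>cls\<close> turns disjoint blocks of representatives into
    disjoint sets of classes.\<close>
  have disjnt: "disjnt (cls ` set ps) (cls ` set qs)"
    if "set ps \<subseteq> set reps" "set qs \<subseteq> set reps" "set ps \<inter> set qs = {}" for ps qs
    using that inj_on_image_Int[OF inj_on_cls, of "set ps" "set qs"] by (simp add: disjnt_def)
  have "partition_on All {Abel, Comm, Non, TrivC, TrivN}"
  proof (rule partition_onI)
    show "\<Union> {Abel, Comm, Non, TrivC, TrivN} = All"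
      by (simp add: all abel comm non trivC trivN reps_def image_Un Un_assoc)
    show "{} \<notin> {Abel, Comm, Non, TrivC, TrivN}"
      using cards by auto
    have "set abel_reps \<inter> set comm_reps = {}" "set abel_reps \<inter> set non_reps = {}"
      "set abel_reps \<inter> set triv_comm_reps = {}" "set abel_reps \<inter> set triv_non_reps = {}"
      "set comm_reps \<inter> set non_reps = {}" "set comm_reps \<inter> set triv_comm_reps = {}"
      "set comm_reps \<inter> set triv_non_reps = {}" "set non_reps \<inter> set triv_comm_reps = {}"
      "set non_reps \<inter> set triv_non_reps = {}" "set triv_comm_reps \<inter> set triv_non_reps = {}"
      using distinct_reps unfolding reps_def distinct_append set_append by blast+
    then have "disjnt Abel Comm" "disjnt Abel Non" "disjnt Abel TrivC" "disjnt Abel TrivN"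
      "disjnt Comm Non" "disjnt Comm TrivC" "disjnt Comm TrivN" "disjnt Non TrivC"
      "disjnt Non TrivN" "disjnt TrivC TrivN"
      unfolding abel comm non trivC trivN by (simp_all add: disjnt sub)
    then show "disjnt p q"
      if "p \<in> {Abel, Comm, Non, TrivC, TrivN}" "q \<in> {Abel, Comm, Non, TrivC, TrivN}" "p \<noteq> q"
      for p q
      using that disjnt_sym by blast
  qed
  \<comment> \<open>The half has a single entry, so its one dual pair is all of
    \<open>Comm\<close>.\<close>
  moreover have "dual_pairs Comm = {Comm}"
    unfolding comm_pairs by (simp add: comm comm_reps_def comm_half_def)
  moreover have "Non = \<Union> (dual_pairs Non) \<union> IsoDual"
    unfolding non_pairs by (auto simp: non non_reps_def iso_dual)
  moreover have "TrivN = \<Union> (dual_pairs TrivN)"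
    unfolding triv_pairs by (auto simp: trivN triv_non_reps_def)
  moreover have "\<forall>D :: 'a bimagma. dimonoid_of_order 3 D \<and> trivial D \<longrightarrow>
      (commutative D \<longleftrightarrow> abelian D)"
    by (auto simp: trivial_def commutative_def abelian_def)
  ultimately show ?thesis
    using cards card_pairs by blast
qed

end
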